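(* Let $\alpha > 0$ be a constant. Suppose that $H$ is a connected graph on $n$ vertices in which at least $(1-\alpha)n$ vertices are cutvertices. Then at least $(1-7\alpha)n$ vertices of $H$ have degree equal to $2$.
   Context: All graphs are finite and simple. A cutvertex of a connected graph $H$ is a vertex $v$ such that $H - v$ is disconnected. *)

theory Defs
  imports Complex_Main "Graph_Theory.Graph_Theory"
begin

text \<open>
  Finite simple graphs are the library's \<open>graph\<close>: finite, loop-free, symmetric digraphs without
  parallel arcs. An undirected edge is a pair of opposite arcs, so the degree of a vertex is its
  \<open>out_degree\<close>. The name \<open>connected\<close> is qualified because it also denotes topological
  connectedness.
\<close>

text \<open>
  The library's \<open>connected\<close> is false for the graph without vertices. That graph must not count as
  disconnected either, since otherwise the vertex of a one-vertex graph would be a cutvertex.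
\<close>

definition disconnected :: "('a, 'b) pre_digraph \<Rightarrow> bool" where
  "disconnected G \<longleftrightarrow> verts G \<noteq> {} \<and> \<not> Digraph_Component.connected G"

definition cutvertex :: "('a, 'b) pre_digraph \<Rightarrow> 'a \<Rightarrow> bool" where
  "cutvertex G v \<longleftrightarrow> v \<in> verts G \<and> disconnected (pre_digraph.del_vert G v)"

end

theory Submission
  imports Defs
begin

text \<open>
  Fix a rooted spanning tree and call a vertex special unless it is a cutvertex with exactly one
  child. Leaves of the tree are not cutvertices, and a tree has fewer branching vertices than leaves,
  so there are fewer than twice as many special vertices as non-cutvertices. If \<open>a\<close> is not special
  and \<open>c\<close> is its child, then no edge joins the descendants of \<open>c\<close> to a vertex other than \<open>a\<close> outside
  of them, since otherwise \<open>H - a\<close> would be connected. Applied to the parent and to the child of a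
  vertex with exactly one child, this shows that these two are its only neighbours, unless it is the
  root or one of the three is special. Fewer vertices are children of special vertices than special,
  which makes up for the root, so at most three times as many vertices as are special, and hence at
  most six times as many as are non-cutvertices, have degree other than two.
\<close>

definition parent_rel :: "'a set \<Rightarrow> 'a \<Rightarrow> ('a \<Rightarrow> 'a) \<Rightarrow> 'a rel" where
  "parent_rel V r par = {(v, par v) |v. v \<in> V - {r}}"

locale rooted_tree =
  fixes V :: "'a set" and r :: 'a and par :: "'a \<Rightarrow> 'a"
  assumes finite_V: "finite V"
    and root_in_V: "r \<in> V"
    and parent_in_V: "v \<in> V \<Longrightarrow> v \<noteq> r \<Longrightarrow> par v \<in> V"
    and acyclic_parent_rel: "acyclic (parent_rel V r par)"
begin

definition children :: "'a \<Rightarrow> 'a set" where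
  "children a = {v \<in> V - {r}. par v = a}"

definition descendants :: "'a \<Rightarrow> 'a set" where
  "descendants a = {x. (x, a) \<in> (parent_rel V r par)\<^sup>*}"

lemma finite_children: "finite (children a)"
  using finite_V by (simp add: children_def)

lemma card_children_cases: "children a = {} \<or> card (children a) = 1 \<or> 2 \<le> card (children a)"
proof -
  have "card (children a) = 0 \<longleftrightarrow> children a = {}" using finite_children by (rule card_0_eq)
  then show ?thesis by linarith
qed

lemma mem_children_iff: "c \<in> children a \<longleftrightarrow> (c, a) \<in> parent_rel V r par"
  by (auto simp: children_def parent_rel_def)

lemma self_in_descendants: "a \<in> descendants a"
  by (simp add: descendants_def)

lemma descendants_trans: "x \<in> descendants y \<Longrightarrow> y \<in> descendants z \<Longrightarrow> x \<in> descendants z"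
  unfolding descendants_def by (auto intro: rtrancl_trans)

lemma descendants_unfold: "descendants a = insert a (\<Union>c \<in> children a. descendants c)"
  unfolding descendants_def by (subst rtrancl_unfold) (auto simp: mem_children_iff)

lemma parent_notin_descendants:
  assumes "c \<in> children a"
  shows "a \<notin> descendants c"
proof
  assume "a \<in> descendants c"
  then have "(a, a) \<in> (parent_rel V r par)\<^sup>+"
    using assms unfolding descendants_def mem_children_iff by auto
  then show False using acyclic_parent_rel by (simp add: acyclic_def)
qed

lemma in_descendants_root:
  assumes "v \<in> V"
  shows "v \<in> descendants r"
proof -
  have "finite (parent_rel V r par)" using finite_V by (simp add: parent_rel_def)
  then have "wf ((parent_rel V r par)\<inverse>)"
    using acyclic_parent_rel by (rule finite_acyclic_wf_converse)
  then show ?thesis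
    using assms
  proof (induction v rule: wf_induct_rule)
    case (less v)
    show ?case
    proof (cases "v = r")
      case False
      then have arc: "(v, par v) \<in> parent_rel V r par"
        using less.prems by (auto simp: parent_rel_def)
      moreover have "par v \<in> descendants r"
        using less arc parent_in_V False by blast
      ultimately show ?thesis
        unfolding descendants_def by (auto intro: converse_rtrancl_into_rtrancl)
    qed (simp add: self_in_descendants)
  qed
qed

lemma sum_card_children:
  assumes "S \<subseteq> V" and "{a \<in> V. card (children a) \<noteq> 1} \<subseteq> S"
  shows "(\<Sum>a\<in>S. card (children a)) + 1 = card S"
proof -
  have "(\<Sum>a\<in>V - S. card (children a)) = (\<Sum>a\<in>V - S. 1)"
    using assms(2) by (intro sum.cong) auto
  then have "(\<Sum>a\<in>S. card (children a)) + card (V - S) = (\<Sum>a\<in>V. card (children a))"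
    using sum.subset_diff[OF assms(1) finite_V, of "\<lambda>a. card (children a)"] by simp
  also have "\<dots> = card (V - {r})"
    using sum.group[of "V - {r}" V par "\<lambda>_. 1::nat"] finite_V parent_in_V
    by (simp add: children_def image_subset_iff)
  also have "\<dots> + 1 = card V"
    using card_Suc_Diff1[OF finite_V root_in_V] by simp
  also have "card V = card S + card (V - S)"
    using assms(1) finite_V by (metis card_Diff_subset card_mono finite_subset le_add_diff_inverse)
  finally show ?thesis by simp
qed

lemma card_branching_less_card_leaves:
  "card {a \<in> V. 2 \<le> card (children a)} < card {a \<in> V. children a = {}}"
proof -
  let ?B = "{a \<in> V. 2 \<le> card (children a)}" and ?L = "{a \<in> V. children a = {}}"
  have fin: "finite ?B" "finite ?L" using finite_V by simp_all
  have disjoint: "?B \<inter> ?L = {}" by auto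
  have "(\<Sum>a\<in>?B \<union> ?L. card (children a)) + 1 = card (?B \<union> ?L)"
    using card_children_cases by (intro sum_card_children) auto
  then have "(\<Sum>a\<in>?B. card (children a)) + 1 = card ?B + card ?L"
    using fin disjoint by (simp add: sum.union_disjoint card_Un_disjoint)
  moreover have "2 * card ?B \<le> (\<Sum>a\<in>?B. card (children a))"
    using sum_bounded_below[of ?B 2 "\<lambda>a. card (children a)"] by simp
  ultimately show ?thesis by simp
qed

end

lemma ex_acyclic_parent_function:
  assumes "\<And>v. v \<in> V \<Longrightarrow> (r, v) \<in> E\<^sup>*"
  obtains par where "\<And>v. v \<in> V - {r} \<Longrightarrow> (par v, v) \<in> E" and "acyclic (parent_rel V r par)"
proof -
  define dist where "dist v = (LEAST n. (r, v) \<in> E ^^ n)" for v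
  have "\<exists>u. (u, v) \<in> E \<and> dist u < dist v" if v: "v \<in> V - {r}" for v
  proof -
    obtain n where "(r, v) \<in> E ^^ n" using assms v rtrancl_imp_relpow by blast
    then have walk: "(r, v) \<in> E ^^ dist v" unfolding dist_def by (rule LeastI)
    then obtain m where m: "dist v = Suc m" using v by (cases "dist v") auto
    then obtain u where u: "(r, u) \<in> E ^^ m" "(u, v) \<in> E" using walk by auto
    then have "dist u \<le> m" unfolding dist_def by (intro Least_le)
    then show ?thesis using u m by auto
  qed
  then obtain par where par: "\<And>v. v \<in> V - {r} \<Longrightarrow> (par v, v) \<in> E \<and> dist (par v) < dist v"
    by metis
  then have "(parent_rel V r par)\<inverse> \<subseteq> measure dist" by (auto simp: parent_rel_def)
  then have "acyclic (parent_rel V r par)"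
    using acyclic_converse acyclic_subset wf_acyclic wf_measure by metis
  with par that show thesis by blast
qed

lemma (in nomulti_digraph) out_degree_eq_card_successors:
  "out_degree G v = card (arcs_ends G `` {v})"
proof -
  have "inj_on (head G) (out_arcs G v)"
    using no_multi_arcs by (auto simp: inj_on_def arc_to_ends_def)
  moreover have "head G ` out_arcs G v = arcs_ends G `` {v}"
    by (auto simp: arcs_ends_conv)
  ultimately show ?thesis unfolding out_degree_def by (metis card_image)
qed

lemma (in pre_digraph) dominates_del_vert_iff:
  "u \<rightarrow>\<^bsub>del_vert a\<^esub> v \<longleftrightarrow> u \<rightarrow>\<^bsub>G\<^esub> v \<and> u \<noteq> a \<and> v \<noteq> a"
  by (auto simp: arcs_ends_conv del_vert_simps)

lemma (in sym_digraph) sym_digraph_del_vert: "sym_digraph (del_vert a)"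
proof -
  interpret D: wf_digraph "del_vert a" by (rule wf_digraph_del_vert)
  show ?thesis
    using sym_arcs
    by (intro D.sym_digraphI) (auto simp: symmetric_def sym_def dominates_del_vert_iff)
qed

lemma (in sym_digraph) not_cutvertexI:
  assumes "\<And>x. x \<in> verts G \<Longrightarrow> x \<noteq> a \<Longrightarrow> x \<rightarrow>\<^sup>*\<^bsub>del_vert a\<^esub> b"
  shows "\<not> cutvertex G a"
proof -
  interpret D: sym_digraph "del_vert a" by (rule sym_digraph_del_vert)
  have "Digraph_Component.connected (del_vert a)" if "verts (del_vert a) \<noteq> {}"
    using that
  proof (rule D.connectedI)
    fix x y assume "x \<in> verts (del_vert a)" "y \<in> verts (del_vert a)"
    then have "x \<rightarrow>\<^sup>*\<^bsub>del_vert a\<^esub> b" "y \<rightarrow>\<^sup>*\<^bsub>del_vert a\<^esub> b"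
      using assms by (auto simp: verts_del_vert)
    then show "x \<rightarrow>\<^sup>*\<^bsub>with_proj (mk_symmetric (del_vert a))\<^esub> y"
      by (blast intro: D.reachable_mk_symmetricI D.reachable_trans D.symmetric_reachable')
  qed
  then show ?thesis by (auto simp: cutvertex_def disconnected_def)
qed

locale rooted_spanning_tree = graph G + rooted_tree "verts G" r par
  for G :: "('a, 'b) pre_digraph" (structure) and r and par +
  assumes dominates_parent: "v \<in> verts G \<Longrightarrow> v \<noteq> r \<Longrightarrow> v \<rightarrow>\<^bsub>G\<^esub> par v"
begin

definition special :: "'a set" where
  "special = {a \<in> verts G. \<not> (cutvertex G a \<and> card (children a) = 1)}"

lemma child_dominates: "c \<in> children a \<Longrightarrow> c \<rightarrow>\<^bsub>G\<^esub> a"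
  using dominates_parent by (auto simp: children_def)

lemma descendant_reachable_del_vert:
  assumes "x \<in> descendants y" "x \<in> verts G" and "x \<in> descendants a \<Longrightarrow> a \<notin> descendants y"
  shows "x \<rightarrow>\<^sup>*\<^bsub>del_vert a\<^esub> y"
proof -
  interpret D: wf_digraph "del_vert a" by (rule wf_digraph_del_vert)
  from assms(1) have "(x, y) \<in> (parent_rel (verts G) r par)\<^sup>*" by (simp add: descendants_def)
  then show ?thesis
    using assms(2,3)
  proof (induction rule: converse_rtrancl_induct)
    case base
    then have "y \<noteq> a" using self_in_descendants by blast
    then show ?case using base by (simp add: verts_del_vert)
  next
    case (step x z)
    have x_child: "x \<in> children z" using step.hyps(1) by (simp add: mem_children_iff)
    have z_below_y: "z \<in> descendants y" using step.hyps(2) by (simp add: descendants_def)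
    have x_below_z: "x \<in> descendants z"
      using x_child descendants_unfold[of z] self_in_descendants by blast
    have z_vert: "z \<in> verts G" using child_dominates[OF x_child] adj_in_verts by blast
    have not_between: "z \<in> descendants a \<Longrightarrow> a \<notin> descendants y"
      using step.prems(2) x_below_z descendants_trans by blast
    have "x \<noteq> a" "z \<noteq> a"
      using step.prems(2) not_between z_below_y x_below_z descendants_trans self_in_descendants
      by blast+
    then have "x \<rightarrow>\<^bsub>del_vert a\<^esub> z"
      using child_dominates[OF x_child] by (simp add: dominates_del_vert_iff)
    then show ?case using step.IH z_vert not_between D.adj_reachable_trans by blast
  qed
qed

lemma nondescendant_reachable_root_del_vert:
  assumes "x \<in> verts G" "x \<notin> descendants a"
  shows "x \<rightarrow>\<^sup>*\<^bsub>del_vert a\<^esub> r"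
  using assms in_descendants_root by (intro descendant_reachable_del_vert) auto

lemma leaf_not_cutvertex:
  assumes "children a = {}"
  shows "\<not> cutvertex G a"
proof (rule not_cutvertexI)
  fix x assume "x \<in> verts G" "x \<noteq> a"
  then show "x \<rightarrow>\<^sup>*\<^bsub>del_vert a\<^esub> r"
    using assms descendants_unfold[of a] by (intro nondescendant_reachable_root_del_vert) auto
qed

lemma escaping_arc_not_cutvertex:
  assumes only_child: "children a = {c}" and arc: "x \<rightarrow>\<^bsub>G\<^esub> y"
    and x: "x \<in> descendants c" and y: "y \<notin> descendants c" "y \<noteq> a"
  shows "\<not> cutvertex G a"
proof (rule not_cutvertexI)
  interpret D: sym_digraph "del_vert a" by (rule sym_digraph_del_vert)
  have descendants_a: "descendants a = insert a (descendants c)"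
    using only_child descendants_unfold[of a] by simp
  have not_above: "a \<notin> descendants c" using only_child parent_notin_descendants by blast
  have below_c: "z \<rightarrow>\<^sup>*\<^bsub>del_vert a\<^esub> c" if "z \<in> descendants c" "z \<in> verts G" for z
    using that not_above by (intro descendant_reachable_del_vert)
  have arc_verts: "x \<in> verts G" "y \<in> verts G" using arc adj_in_verts by auto
  have "c \<rightarrow>\<^sup>*\<^bsub>del_vert a\<^esub> x" using below_c x arc_verts D.symmetric_reachable' by blast
  also have "x \<rightarrow>\<^bsub>del_vert a\<^esub> y" using arc x y not_above by (auto simp: dominates_del_vert_iff)
  also have "y \<rightarrow>\<^sup>*\<^bsub>del_vert a\<^esub> r"
    using y arc_verts descendants_a by (intro nondescendant_reachable_root_del_vert) auto
  finally have child_to_root: "c \<rightarrow>\<^sup>*\<^bsub>del_vert a\<^esub> r" .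
  fix z assume z: "z \<in> verts G" "z \<noteq> a"
  show "z \<rightarrow>\<^sup>*\<^bsub>del_vert a\<^esub> r"
  proof (cases "z \<in> descendants c")
    case True
    then show ?thesis using below_c z child_to_root D.reachable_trans by blast
  next
    case False
    then show ?thesis using z descendants_a nondescendant_reachable_root_del_vert by blast
  qed
qed

lemma not_specialE:
  assumes "a \<in> verts G" "a \<notin> special"
  obtains c where "cutvertex G a" "children a = {c}"
  using assms by (auto simp: special_def card_1_singleton_iff)

lemma successors_eq_parent_child:
  assumes v: "v \<in> verts G" "v \<noteq> r" and only_child: "children v = {c}"
    and neighbours: "par v \<notin> special" "c \<notin> special"
  shows "arcs_ends G `` {v} = {par v, c}"
proof (intro equalityI subsetI)
  fix w assume "w \<in> arcs_ends G `` {v}"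
  then have arc: "v \<rightarrow>\<^bsub>G\<^esub> w" and rev_arc: "w \<rightarrow>\<^bsub>G\<^esub> v"
    using arcs_ends_symmetric[OF sym_arcs] by auto
  have child: "c \<in> children v" "c \<in> verts G" using only_child by (auto simp: children_def)
  have parent: "par v \<in> verts G" "v \<in> children (par v)"
    using v parent_in_V by (auto simp: children_def)
  moreover obtain v' where parent_cut: "cutvertex G (par v)" and "children (par v) = {v'}"
    using parent(1) neighbours(1) by (rule not_specialE)
  ultimately have "children (par v) = {v}" by simp
  then have parent_or_below: "w = par v \<or> w \<in> descendants v"
    using escaping_arc_not_cutvertex parent_cut arc self_in_descendants by blast
  obtain d where child_cut: "cutvertex G c" and only_grandchild: "children c = {d}"
    using child(2) neighbours(2) by (rule not_specialE)
  have "v \<notin> descendants c" using child(1) by (rule parent_notin_descendants)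
  then have "v \<notin> descendants d" "v \<noteq> c"
    using only_grandchild descendants_unfold[of c] self_in_descendants by auto
  then have "w \<notin> descendants d"
    using escaping_arc_not_cutvertex child_cut only_grandchild rev_arc by blast
  moreover have "descendants v = {v, c} \<union> descendants d"
    using only_child only_grandchild descendants_unfold[of v] descendants_unfold[of c] by auto
  moreover have "w \<noteq> v" using arc adj_not_same by blast
  ultimately show "w \<in> {par v, c}" using parent_or_below by blast
next
  fix w assume "w \<in> {par v, c}"
  moreover have "v \<rightarrow>\<^bsub>G\<^esub> par v" using dominates_parent v by blast
  moreover have "v \<rightarrow>\<^bsub>G\<^esub> c"
    using only_child child_dominates arcs_ends_symmetric[OF sym_arcs] by blast
  ultimately show "w \<in> arcs_ends G `` {v}" by blast
qed

lemma out_degree_eq_2: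
  assumes v: "v \<in> verts G" "v \<noteq> r" "v \<notin> special"
    and not_near: "v \<notin> (\<Union>a\<in>special. children a)" "v \<notin> par ` special"
  shows "out_degree G v = 2"
proof -
  obtain c where only_child: "children v = {c}" using v(1,3) by (rule not_specialE)
  have "par v \<notin> special" using not_near(1) v by (auto simp: children_def)
  moreover have "c \<notin> special" using not_near(2) only_child by (auto simp: children_def)
  ultimately have "arcs_ends G `` {v} = {par v, c}"
    using v only_child by (intro successors_eq_parent_child)
  moreover have "par v \<notin> descendants v"
    using v by (intro parent_notin_descendants) (simp add: children_def)
  then have "par v \<noteq> c"
    using only_child descendants_unfold[of v] self_in_descendants by auto
  ultimately show ?thesis by (simp add: out_degree_eq_card_successors)
qed

lemma card_special_less: "card special < 2 * card {a \<in> verts G. \<not> cutvertex G a}"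
proof -
  let ?K = "{a \<in> verts G. \<not> cutvertex G a}" and ?B = "{a \<in> verts G. 2 \<le> card (children a)}"
  have leaves: "{a \<in> verts G. children a = {}} \<subseteq> ?K" using leaf_not_cutvertex by auto
  have "special \<subseteq> ?K \<union> ?B"
    unfolding special_def using card_children_cases leaf_not_cutvertex by blast
  then have "card special \<le> card (?K \<union> ?B)" by (intro card_mono) auto
  also have "\<dots> \<le> card ?K + card ?B" by (rule card_Un_le)
  also have "card ?B < card {a \<in> verts G. children a = {}}"
    by (rule card_branching_less_card_leaves)
  also have "\<dots> \<le> card ?K" using leaves by (intro card_mono) auto
  finally show ?thesis by simp
qed

lemma card_out_degree_neq_2_le:
  "card {v \<in> verts G. out_degree G v \<noteq> 2} \<le> 6 * card {v \<in> verts G. \<not> cutvertex G v}"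
proof -
  let ?C = "\<Union>a\<in>special. children a" and ?P = "par ` special"
  have special: "special \<subseteq> verts G" by (auto simp: special_def)
  then have fin: "finite special" by (rule finite_subset) simp
  have "(\<Sum>a\<in>special. card (children a)) + 1 = card special"
    using special by (intro sum_card_children) (auto simp: special_def)
  then have card_C: "card ?C + 1 \<le> card special"
    using card_UN_le[OF fin, of children] by simp
  have card_P: "card ?P \<le> card special" using fin by (rule card_image_le)
  have "{v \<in> verts G. out_degree G v \<noteq> 2} \<subseteq> {r} \<union> special \<union> ?C \<union> ?P"
    using out_degree_eq_2 by blast
  then have "card {v \<in> verts G. out_degree G v \<noteq> 2} \<le> card ({r} \<union> special \<union> ?C \<union> ?P)"
    using fin finite_children by (intro card_mono) auto
  also have "\<dots> \<le> 1 + card special + card ?C + card ?P"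
    using card_Un_le[of "{r} \<union> special \<union> ?C" ?P] card_Un_le[of "{r} \<union> special" ?C]
      card_Un_le[of "{r}" special] by simp
  also have "\<dots> \<le> 3 * card special" using card_C card_P by simp
  also have "\<dots> \<le> 6 * card {v \<in> verts G. \<not> cutvertex G v}" using card_special_less by simp
  finally show ?thesis .
qed

end

lemma (in graph) connected_ex_rooted_spanning_tree:
  assumes "Digraph_Component.connected G"
  obtains r par where "rooted_spanning_tree G r par"
proof -
  have sc: "strongly_connected G"
    using sym_arcs assms by (rule symmetric_connected_imp_strongly_connected)
  then obtain r where r: "r \<in> verts G" by (auto simp: strongly_connected_def)
  have "(r, v) \<in> (arcs_ends G)\<^sup>*" if "v \<in> verts G" for v
    using sc r that by (auto intro: reachable_rtranclI)
  then obtain par where arc: "\<And>v. v \<in> verts G - {r} \<Longrightarrow> par v \<rightarrow>\<^bsub>G\<^esub> v"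
    and "acyclic (parent_rel (verts G) r par)"
    using ex_acyclic_parent_function[of "verts G" r "arcs_ends G"] by metis
  moreover have "v \<rightarrow>\<^bsub>G\<^esub> par v" if "v \<in> verts G" "v \<noteq> r" for v
    using arc that arcs_ends_symmetric[OF sym_arcs] by blast
  ultimately have "rooted_spanning_tree G r par"
    using r adj_in_verts by unfold_locales auto
  then show thesis by (rule that)
qed

theorem lemma8:
  fixes \<alpha> :: real and H :: "('a, 'b) pre_digraph" and n :: nat
  assumes "\<alpha> > 0"
    and "graph H"
    and "Digraph_Component.connected H"
    and "card (verts H) = n"
    and "real (card {v \<in> verts H. cutvertex H v}) \<ge> (1 - \<alpha>) * real n"
  shows "real (card {v \<in> verts H. out_degree H v = 2}) \<ge> (1 - 7 * \<alpha>) * real n"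
proof -
  interpret graph H by fact
  obtain r par where "rooted_spanning_tree H r par"
    using assms(3) by (rule connected_ex_rooted_spanning_tree)
  then have few: "card {v \<in> verts H. out_degree H v \<noteq> 2} \<le> 6 * card {v \<in> verts H. \<not> cutvertex H v}"
    by (rule rooted_spanning_tree.card_out_degree_neq_2_le)
  have complement: "card {v \<in> verts H. P v} + card {v \<in> verts H. \<not> P v} = n" for P
    using assms(4) card_Int_Diff[of "verts H" "Collect P"] by (simp add: Int_def set_diff_eq)
  have "real (card {v \<in> verts H. \<not> cutvertex H v}) \<le> \<alpha> * real n"
    using assms(5) complement[of "cutvertex H"] by (simp add: algebra_simps flip: of_nat_add)
  then have "real (card {v \<in> verts H. out_degree H v \<noteq> 2}) \<le> 6 * (\<alpha> * real n)"
    using few by linarith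
  moreover have "0 \<le> \<alpha> * real n" using assms(1) by simp
  ultimately show ?thesis
    using complement[of "\<lambda>v. out_degree H v = 2"] by (simp add: algebra_simps flip: of_nat_add)
qed

end
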